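(* Let $p$ be a prime, let $n$ be a positive integer, and let $\Sigma_n = (\sigma_{n,1},\ldots,\sigma_{n,n})$ and $\Sigma_n' = (\sigma_{n,1}',\ldots,\sigma_{n,n}')$ be $n$-tuples of subsets of $[n]$ with $\Sigma_n \le \Sigma_n'$. Let $\overline{X_n}$ (resp. $\overline{X_n'}$) be a uniform random matrix in $\mathrm{M}_n(\mathbb{F}_p)$ supported on $\Sigma_n$ (resp. $\Sigma_n'$). Then $$\mathbb{P}(\det(\overline{X_n}) \neq 0) \le \mathbb{P}(\det(\overline{X_n'}) \neq 0).$$
   Context: $[n] = \{1,\ldots,n\}$; $\mathbb{F}_p$ is the field with $p$ elements. A uniform random matrix in $\mathrm{M}_n(\mathbb{F}_p)$ supported on $\Sigma_n = (\sigma_{n,1},\ldots,\sigma_{n,n})$ is a random $n\times n$ matrix whose $(i,j)$ entries (row $i$, column $j$) with $i \in \sigma_{n,j}$ are independent and uniformly distributed in $\mathbb{F}_p$, and whose $(i,j)$ entries with $i \notin \sigma_{n,j}$ are $0$. $\Sigma_n \le \Sigma_n'$ means $\sigma_{n,i} \subseteq \sigma_{n,i}'$ for each $i \in [n]$. *)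

theory Defs
  imports
    "HOL-Probability.Probability"
    "Jordan_Normal_Form.Determinant"
    "Berlekamp_Zassenhaus.Finite_Field"
begin

text \<open>
  The field with \<open>p\<close> elements is \<open>'p mod_ring\<close> with \<open>'p :: prime_card\<close>, so \<open>p = CARD('p)\<close>.
  Rows and columns are numbered from 0, as in Jordan_Normal_Form; the index set is \<open>{..<n}\<close>
  in place of \<open>{1..n}\<close>.  A tuple of \<open>n\<close> subsets is a function \<open>S :: nat \<Rightarrow> nat set\<close> of which only
  \<open>S 0, \<dots>, S (n - 1)\<close> matter.
\<close>

definition support_tuple :: "nat \<Rightarrow> (nat \<Rightarrow> nat set) \<Rightarrow> bool" where
  "support_tuple n S \<longleftrightarrow> (\<forall>j<n. S j \<subseteq> {..<n})"

definition support_le :: "nat \<Rightarrow> (nat \<Rightarrow> nat set) \<Rightarrow> (nat \<Rightarrow> nat set) \<Rightarrow> bool" where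
  "support_le n S S' \<longleftrightarrow> (\<forall>j<n. S j \<subseteq> S' j)"

definition uniform_random_matrix ::
  "nat \<Rightarrow> (nat \<Rightarrow> nat set) \<Rightarrow> 'w measure \<Rightarrow> ('w \<Rightarrow> 'p::prime_card mod_ring mat) \<Rightarrow> bool" where
  "uniform_random_matrix n S M X \<longleftrightarrow>
     prob_space M \<and>
     X \<in> measurable M (count_space (carrier_mat n n)) \<and>
     prob_space.indep_vars M (\<lambda>_. count_space UNIV) (\<lambda>(i, j) w. X w $$ (i, j))
       {(i, j). i < n \<and> j < n \<and> i \<in> S j} \<and>
     (\<forall>i<n. \<forall>j<n. i \<in> S j \<longrightarrow>
       distr M (count_space UNIV) (\<lambda>w. X w $$ (i, j)) = uniform_count_measure UNIV) \<and>
     (\<forall>i<n. \<forall>j<n. i \<notin> S j \<longrightarrow> (AE w in M. X w $$ (i, j) = 0))"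

end

theory Submission imports Defs begin

text \<open>
  Fix all columns of a matrix except column \<open>j\<close>.  By Laplace expansion along that column, the
  determinant is a linear form in its entries, whose coefficients are cofactors that do not
  involve column \<open>j\<close>.  A linear form over \<open>\<bbbF>\<^sub>p\<close> on the vectors supported on a set is either zero
  or nonzero on exactly a proportion \<open>1 - 1/p\<close> of them; allowing one more position in column \<open>j\<close>
  can only turn the first case into the second.  Averaging over the other columns,
  the proportion of nonsingular matrices among those with a prescribed support does not decrease
  when the support gains a position.

  In place of an average over columns, this comparison is carried out by an injection in \<open>card_nonsingular_insert_position\<close>: inside column \<open>j\<close>, a
  nonsingular matrix can receive any of the \<open>p\<close> values at the new position, and a compensating
  change at an old position with nonzero cofactor keeps the determinant.  So there are at least
  \<open>p\<close> times as many nonsingular matrices on the larger support.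
  Iteration gives \<open>nonsingular_proportion_mono\<close>, a statement about counting only.  The probabilistic
  statement reduces to it because a uniform random matrix takes each matrix with the given
  support with the same probability (\<open>prob_eq_supported_mat\<close>).
\<close>

section \<open>Counting nonsingular matrices with a given support\<close>

definition supported_mat :: "nat \<Rightarrow> (nat \<times> nat) set \<Rightarrow> 'a::zero mat set" where
  "supported_mat n P = {A \<in> carrier_mat n n. \<forall>i<n. \<forall>j<n. (i, j) \<notin> P \<longrightarrow> A $$ (i, j) = 0}"

lemma finite_carrier_mat: "finite (carrier_mat m n :: 'a::finite mat set)"
proof -
  let ?I = "{..<m} \<times> {..<n}"
  have "inj_on (\<lambda>A. restrict (($$) A) ?I) (carrier_mat m n :: 'a mat set)"
  proof (rule inj_onI)
    fix A B :: "'a mat"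
    assume AB: "A \<in> carrier_mat m n" "B \<in> carrier_mat m n"
      and eq: "restrict (($$) A) ?I = restrict (($$) B) ?I"
    show "A = B"
    proof (rule eq_matI)
      fix i j assume "i < dim_row B" "j < dim_col B"
      then show "A $$ (i, j) = B $$ (i, j)"
        using fun_cong[OF eq, of "(i, j)"] AB by auto
    qed (use AB in auto)
  qed
  moreover have "(\<lambda>A. restrict (($$) A) ?I) ` (carrier_mat m n :: 'a mat set) \<subseteq> PiE ?I (\<lambda>_. UNIV)"
    by (intro image_subsetI) (simp add: restrict_PiE_iff)
  moreover have "finite (PiE ?I (\<lambda>_. UNIV :: 'a set))"
    by (intro finite_PiE) auto
  ultimately show ?thesis
    by (meson finite_imageD finite_subset)
qed

lemma finite_supported_mat: "finite (supported_mat n P :: 'a::{finite, zero} mat set)"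
  by (rule finite_subset[OF _ finite_carrier_mat[of n n]]) (auto simp: supported_mat_def)

lemma supported_mat_eqI:
  assumes "A \<in> supported_mat n P" and "B \<in> supported_mat n P"
    and "\<And>e. e \<in> P \<Longrightarrow> A $$ e = B $$ e"
  shows "A = B"
proof (rule eq_matI)
  fix i j assume "i < dim_row B" "j < dim_col B"
  then show "A $$ (i, j) = B $$ (i, j)"
    using assms by (cases "(i, j) \<in> P") (auto simp: supported_mat_def)
qed (use assms(1,2) in \<open>auto simp: supported_mat_def\<close>)

lemma cofactor_cong_off_column:
  assumes "A \<in> carrier_mat n n" and "B \<in> carrier_mat n n" and "k < n" and "j < n"
    and "\<And>r c. r < n \<Longrightarrow> c < n \<Longrightarrow> c \<noteq> j \<Longrightarrow> A $$ (r, c) = B $$ (r, c)"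
  shows "cofactor A k j = cofactor B k j"
proof -
  have "mat_delete A k j = mat_delete B k j"
    unfolding mat_delete_def using assms by (intro eq_matI) auto
  then show ?thesis
    by (simp add: cofactor_def)
qed

text \<open>
  Send a nonsingular \<open>A\<close> supported on \<open>P\<close> and a scalar \<open>t\<close> to the matrix with \<open>t\<close> at the new
  position \<open>(i, j)\<close>, and correct the entry at a pivot \<open>(k, j) \<in> P\<close> with nonzero cofactor so that
  the determinant stays the same.  A pivot exists since \<open>det A \<noteq> 0\<close>.  The map is injective: the
  pivot is chosen by looking only at cofactors along column \<open>j\<close>, which the map does not change, so
  the image determines \<open>t\<close>, the pivot and the correction, hence \<open>A\<close>.
\<close>

lemma card_nonsingular_insert_position:
  fixes P :: "(nat \<times> nat) set"
  assumes "i < n" and "j < n" and new: "(i, j) \<notin> P"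
  shows "CARD('a) * card {A \<in> supported_mat n P. Determinant.det A \<noteq> (0 :: 'a::{finite, field})}
    \<le> card {A \<in> supported_mat n (insert (i, j) P). Determinant.det A \<noteq> (0 :: 'a)}"
proof -
  define piv :: "'a mat \<Rightarrow> nat" where
    "piv A = (SOME k. k < n \<and> (k, j) \<in> P \<and> cofactor A k j \<noteq> 0)" for A
  \<comment> \<open>the new entry adds \<open>t * cofactor A i j\<close> to the Laplace expansion, and the pivot entry takes it away\<close>
  define shift :: "'a mat \<Rightarrow> 'a \<Rightarrow> 'a mat" where
    "shift A t = mat n n (\<lambda>(r, c). A $$ (r, c)
        + (if c = j \<and> r = i then t else 0)
        - (if c = j \<and> r = piv A then t * cofactor A i j / cofactor A (piv A) j else 0))" for A t
  let ?N = "\<lambda>P. {A \<in> supported_mat n P. Determinant.det A \<noteq> (0 :: 'a)}"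
  have piv: "piv A < n" "(piv A, j) \<in> P" "cofactor A (piv A) j \<noteq> 0" if "A \<in> ?N P" for A
  proof -
    have A: "A \<in> carrier_mat n n"
      and zero: "\<And>r. r < n \<Longrightarrow> (r, j) \<notin> P \<Longrightarrow> A $$ (r, j) = 0"
      using that \<open>j < n\<close> by (auto simp: supported_mat_def)
    have "(\<Sum>r<n. A $$ (r, j) * cofactor A r j) \<noteq> 0"
      using that laplace_expansion_column[OF A \<open>j < n\<close>] by simp
    then obtain r where "r < n" "A $$ (r, j) * cofactor A r j \<noteq> 0"
      by (metis (no_types, lifting) lessThan_iff sum.neutral)
    then have "\<exists>k. k < n \<and> (k, j) \<in> P \<and> cofactor A k j \<noteq> 0"
      using zero by auto
    from someI_ex[OF this] show "piv A < n" "(piv A, j) \<in> P" "cofactor A (piv A) j \<noteq> 0"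
      unfolding piv_def by auto
  qed
  have shift_carrier: "shift A t \<in> carrier_mat n n" for A t
    by (simp add: shift_def)
  have cof_shift: "cofactor (shift A t) k j = cofactor A k j"
    if "A \<in> ?N P" "k < n" for A t k
    by (rule cofactor_cong_off_column[OF shift_carrier])
      (use that \<open>j < n\<close> in \<open>auto simp: supported_mat_def shift_def\<close>)
  have shift_N: "shift A t \<in> ?N (insert (i, j) P)" if N: "A \<in> ?N P" for A t
  proof -
    have A: "A \<in> carrier_mat n n"
      using N by (simp add: supported_mat_def)
    have "Determinant.det (shift A t) = (\<Sum>r<n. shift A t $$ (r, j) * cofactor A r j)"
      using laplace_expansion_column[OF shift_carrier \<open>j < n\<close>] cof_shift[OF N] by simp
    also have "\<dots> = (\<Sum>r<n. A $$ (r, j) * cofactor A r j + (if r = i then t * cofactor A i j else 0)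
        - (if r = piv A then t * cofactor A i j else 0))"
      using \<open>j < n\<close> piv[OF N] by (intro sum.cong) (auto simp: shift_def algebra_simps)
    also have "\<dots> = Determinant.det A"
      using laplace_expansion_column[OF A \<open>j < n\<close>] piv(1)[OF N] \<open>i < n\<close>
      by (simp add: sum.distrib sum_subtractf)
    finally have "Determinant.det (shift A t) \<noteq> 0"
      using N by simp
    moreover have "shift A t \<in> supported_mat n (insert (i, j) P)"
      using N piv[OF N] by (auto simp: supported_mat_def shift_def)
    ultimately show ?thesis by simp
  qed
  have "inj_on (\<lambda>(A, t). shift A t) (?N P \<times> UNIV)"
  proof (rule inj_onI, clarify)
    fix A B s t
    assume NA: "A \<in> supported_mat n P" "Determinant.det A \<noteq> 0"
      and NB: "B \<in> supported_mat n P" "Determinant.det B \<noteq> 0"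
      and eq: "shift A s = shift B t"
    have A: "A \<in> ?N P" and B: "B \<in> ?N P" using NA NB by auto
    \<comment> \<open>the cofactors along column \<open>j\<close> can be read off the image, so both preimages have the same pivot\<close>
    have cof: "cofactor A k j = cofactor B k j" if "k < n" for k
      using cof_shift[OF A that, of s] cof_shift[OF B that, of t] eq by simp
    then have piv_eq: "piv A = piv B"
      unfolding piv_def by (metis (no_types, lifting))
    \<comment> \<open>the correction misses the new position, where both preimages vanish, so the image shows the scalar there\<close>
    have "piv B \<noteq> i" using piv(2)[OF B] new by auto
    moreover have "A $$ (i, j) = 0" "B $$ (i, j) = 0"
      using NA NB assms by (auto simp: supported_mat_def)
    moreover have "shift A s $$ (i, j) = shift B t $$ (i, j)" using eq by simp
    ultimately have st: "s = t"
      using \<open>i < n\<close> \<open>j < n\<close> by (simp add: shift_def piv_eq)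
    have "A = B"
    proof (rule eq_matI)
      fix r c assume "r < dim_row B" "c < dim_col B"
      then have "r < n" "c < n" using NB by (auto simp: supported_mat_def)
      moreover have "shift A s $$ (r, c) = shift B t $$ (r, c)" using eq by simp
      ultimately show "A $$ (r, c) = B $$ (r, c)"
        using cof[OF \<open>i < n\<close>] cof[OF piv(1)[OF B]]
        by (simp add: shift_def piv_eq st split: if_splits)
    qed (use NA NB in \<open>auto simp: supported_mat_def\<close>)
    then show "A = B \<and> s = t" using st by simp
  qed
  moreover have "(\<lambda>(A, t). shift A t) ` (?N P \<times> UNIV) \<subseteq> ?N (insert (i, j) P)"
    using shift_N by auto
  moreover have "finite (?N (insert (i, j) P))"
    by (simp add: finite_supported_mat)
  ultimately have "card (?N P \<times> (UNIV :: 'a set)) \<le> card (?N (insert (i, j) P))"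
    by (rule card_inj_on_le)
  then show ?thesis
    by (simp add: card_cartesian_product mult.commute)
qed

lemma nonsingular_proportion_mono:
  fixes P Q :: "(nat \<times> nat) set"
  assumes "P \<subseteq> Q" and "Q \<subseteq> {..<n} \<times> {..<n}"
  shows "real (card {A \<in> supported_mat n P. Determinant.det A \<noteq> (0 :: 'a::{finite, field})}) / CARD('a) ^ card P
    \<le> real (card {A \<in> supported_mat n Q. Determinant.det A \<noteq> (0 :: 'a)}) / CARD('a) ^ card Q"
proof -
  let ?g = "\<lambda>P. real (card {A \<in> supported_mat n P. Determinant.det A \<noteq> (0 :: 'a)}) / CARD('a) ^ card P"
  have fin: "finite Q"
    using assms(2) by (rule finite_subset) simp
  have "?g P \<le> ?g (P \<union> D)" if "finite D" "D \<subseteq> Q - P" for D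
    using that
  proof (induction D)
    case (insert e D)
    obtain i j where e: "e = (i, j)" by (cases e)
    have new: "(i, j) \<notin> P \<union> D" "i < n" "j < n"
      using insert.hyps insert.prems assms(2) e by auto
    have finPD: "finite (P \<union> D)"
      using fin assms(1) insert.hyps finite_subset by auto
    have "?g P \<le> ?g (P \<union> D)"
      using insert by simp
    also have "\<dots> = real (CARD('a) * card {A \<in> supported_mat n (P \<union> D). Determinant.det A \<noteq> (0 :: 'a)})
        / CARD('a) ^ card (insert e (P \<union> D))"
      using finPD new(1) e by simp
    also have "\<dots> \<le> ?g (insert e (P \<union> D))"
      unfolding e using card_nonsingular_insert_position[OF new(2,3,1), where 'a = 'a]
      by (intro divide_right_mono of_nat_mono) simp_all
    finally show ?case by simp
  qed simp
  from this[of "Q - P"] show ?thesis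
    using fin assms(1) by (simp add: Un_absorb1)
qed

section \<open>From uniform random matrices to counting\<close>

abbreviation support_positions :: "nat \<Rightarrow> (nat \<Rightarrow> nat set) \<Rightarrow> (nat \<times> nat) set" where
  "support_positions n S \<equiv> {(i, j). i < n \<and> j < n \<and> i \<in> S j}"

lemma AE_supported_mat:
  assumes "uniform_random_matrix n S M X"
  shows "AE w in M. X w \<in> supported_mat n (support_positions n S)"
proof -
  have "X \<in> measurable M (count_space (carrier_mat n n))"
    and zero: "\<And>i j. i < n \<Longrightarrow> j < n \<Longrightarrow> i \<notin> S j \<Longrightarrow> (AE w in M. X w $$ (i, j) = 0)"
    using assms by (auto simp: uniform_random_matrix_def)
  then have "AE w in M. X w \<in> carrier_mat n n"
    by (intro AE_I2) (auto dest: measurable_space)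
  moreover have "AE w in M. \<forall>e\<in>{..<n} \<times> {..<n} - support_positions n S. X w $$ e = 0"
    by (rule AE_finite_allI) (use zero in auto)
  ultimately show ?thesis
    by eventually_elim (auto simp: supported_mat_def)
qed

text \<open>
  Almost surely \<open>X\<close> vanishes off the support, so \<open>X = A\<close> is up to a null set the intersection of
  the independent events that the entries on the support agree, each of probability \<open>1/p\<close>.
\<close>

lemma prob_eq_supported_mat:
  fixes X :: "'w \<Rightarrow> 'p::prime_card mod_ring mat"
  assumes X: "uniform_random_matrix n S M X" and A: "A \<in> supported_mat n (support_positions n S)"
  shows "measure M {w \<in> space M. X w = A} = 1 / CARD('p) ^ card (support_positions n S)"
proof -
  let ?P = "support_positions n S"
  interpret prob_space M using X by (simp add: uniform_random_matrix_def)
  have Xm [measurable]: "X \<in> measurable M (count_space (carrier_mat n n))"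
    and ind: "indep_vars (\<lambda>_. count_space UNIV) (\<lambda>(i, j) w. X w $$ (i, j)) ?P"
    and unif: "\<And>i j. i < n \<Longrightarrow> j < n \<Longrightarrow> i \<in> S j \<Longrightarrow>
       distr M (count_space UNIV) (\<lambda>w. X w $$ (i, j)) = uniform_count_measure UNIV"
    using X by (auto simp: uniform_random_matrix_def)
  have entry [measurable]: "(\<lambda>w. X w $$ e) \<in> measurable M (count_space UNIV)" for e
    by (rule measurable_compose[OF Xm]) simp
  have finP: "finite ?P"
    by (rule finite_subset[of _ "{..<n} \<times> {..<n}"]) auto
  have one: "prob ((\<lambda>w. X w $$ e) -` {A $$ e} \<inter> space M) = 1 / CARD('p)" if mem: "e \<in> ?P" for e
  proof -
    obtain i j where e: "e = (i, j)" "i < n" "j < n" "i \<in> S j"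
      using mem by (cases e) auto
    have "prob ((\<lambda>w. X w $$ e) -` {A $$ e} \<inter> space M)
        = measure (distr M (count_space UNIV) (\<lambda>w. X w $$ e)) {A $$ e}"
      by (subst measure_distr) auto
    also have "\<dots> = 1 / CARD('p)"
      using unif[OF e(2-4)] e(1) by (simp add: measure_uniform_count_measure CARD_mod_ring)
    finally show ?thesis .
  qed
  have "prob {w \<in> space M. X w = A} = prob {w \<in> space M. \<forall>e\<in>?P. X w $$ e = A $$ e}"
  proof (rule finite_measure_eq_AE)
    show "AE w in M. (w \<in> {w \<in> space M. X w = A}) = (w \<in> {w \<in> space M. \<forall>e\<in>?P. X w $$ e = A $$ e})"
      using AE_supported_mat[OF X]
    proof eventually_elim
      case (elim w)
      then have "X w = A" if "\<forall>e\<in>?P. X w $$ e = A $$ e"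
        using supported_mat_eqI[OF elim A] that by blast
      then show ?case by auto
    qed
    show "{w \<in> space M. X w = A} \<in> events"
      using measurable_sets[OF Xm, of "{A}"] A
      by (auto simp: supported_mat_def vimage_def Int_def conj_commute)
    show "{w \<in> space M. \<forall>e\<in>?P. X w $$ e = A $$ e} \<in> events"
      using finP by (intro sets.sets_Collect_finite_All) measurable
  qed
  \<comment> \<open>an intersection over an empty index set would be everything, not \<^term>\<open>space M\<close>\<close>
  also have "\<dots> = (\<Prod>e\<in>?P. prob ((\<lambda>w. X w $$ e) -` {A $$ e} \<inter> space M))"
  proof (cases "?P = {}")
    case True
    then show ?thesis by (simp only: True) (simp add: prob_space)
  next
    case False
    have "{w \<in> space M. \<forall>e\<in>?P. X w $$ e = A $$ e} = (\<Inter>e\<in>?P. (\<lambda>(i, j) w. X w $$ (i, j)) e -` {A $$ e} \<inter> space M)"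
      using False by auto
    also have "prob \<dots> = (\<Prod>e\<in>?P. prob ((\<lambda>(i, j) w. X w $$ (i, j)) e -` {A $$ e} \<inter> space M))"
      using indep_varsD[OF ind False finP order.refl, of "\<lambda>e. {A $$ e}"] by simp
    also have "\<dots> = (\<Prod>e\<in>?P. prob ((\<lambda>w. X w $$ e) -` {A $$ e} \<inter> space M))"
      by (rule prod.cong) auto
    finally show ?thesis .
  qed
  also have "\<dots> = (\<Prod>e\<in>?P. 1 / CARD('p))"
    by (intro prod.cong one) auto
  also have "\<dots> = 1 / CARD('p) ^ card ?P"
    by (simp add: power_one_over)
  finally show ?thesis .
qed

lemma prob_nonsingular_eq_proportion:
  fixes X :: "'w \<Rightarrow> 'p::prime_card mod_ring mat"
  assumes X: "uniform_random_matrix n S M X"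
  shows "measure M {w \<in> space M. Determinant.det (X w) \<noteq> 0}
    = real (card {A \<in> supported_mat n (support_positions n S). Determinant.det A \<noteq> (0 :: 'p mod_ring)})
      / CARD('p) ^ card (support_positions n S)"
proof -
  let ?P = "support_positions n S"
  let ?N = "{A \<in> supported_mat n ?P. Determinant.det A \<noteq> (0 :: 'p mod_ring)}"
  interpret prob_space M using X by (simp add: uniform_random_matrix_def)
  have Xm: "X \<in> measurable M (count_space (carrier_mat n n))"
    using X by (auto simp: uniform_random_matrix_def)
  have ev: "{w \<in> space M. X w \<in> B} \<in> events" for B
  proof -
    have "{w \<in> space M. X w \<in> B} = X -` (B \<inter> carrier_mat n n) \<inter> space M"
      using measurable_space[OF Xm] by auto
    then show ?thesis
      using measurable_sets[OF Xm, of "B \<inter> carrier_mat n n"] by simp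
  qed
  have finN: "finite ?N"
    by (simp add: finite_supported_mat)
  have "prob {w \<in> space M. Determinant.det (X w) \<noteq> 0} = prob (\<Union>A\<in>?N. {w \<in> space M. X w = A})"
  proof (rule finite_measure_eq_AE)
    show "AE w in M. (w \<in> {w \<in> space M. Determinant.det (X w) \<noteq> 0})
        = (w \<in> (\<Union>A\<in>?N. {w \<in> space M. X w = A}))"
      using AE_supported_mat[OF X] by eventually_elim auto
    show "{w \<in> space M. Determinant.det (X w) \<noteq> 0} \<in> events"
      using ev[of "{A. Determinant.det A \<noteq> 0}"] by simp
    show "(\<Union>A\<in>?N. {w \<in> space M. X w = A}) \<in> events"
      using finN ev[of "{A}" for A] by (intro sets.finite_UN) auto
  qed
  also have "\<dots> = (\<Sum>A\<in>?N. prob {w \<in> space M. X w = A})"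
    using ev[of "{A}" for A] finN
    by (intro finite_measure_finite_Union) (auto simp: disjoint_family_on_def)
  also have "\<dots> = (\<Sum>A\<in>?N. 1 / CARD('p) ^ card ?P)"
    by (intro sum.cong prob_eq_supported_mat[OF X]) auto
  finally show ?thesis by simp
qed

theorem lemma4p1:
  fixes n :: nat
    and S S' :: "nat \<Rightarrow> nat set"
    and M :: "'w measure" and M' :: "'v measure"
    and X :: "'w \<Rightarrow> 'p::prime_card mod_ring mat"
    and X' :: "'v \<Rightarrow> 'p mod_ring mat"
  assumes "0 < n"
    and "support_tuple n S" and "support_tuple n S'"
    and "support_le n S S'"
    and "uniform_random_matrix n S M X"
    and "uniform_random_matrix n S' M' X'"
  shows "measure M {w \<in> space M. Determinant.det (X w) \<noteq> 0}
    \<le> measure M' {w \<in> space M'. Determinant.det (X' w) \<noteq> 0}"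
proof -
  have "support_positions n S \<subseteq> support_positions n S'"
    and "support_positions n S' \<subseteq> {..<n} \<times> {..<n}"
    using assms(4) by (auto simp: support_le_def)
  from nonsingular_proportion_mono[OF this, where 'a = "'p mod_ring"] show ?thesis
    unfolding prob_nonsingular_eq_proportion[OF assms(5)] prob_nonsingular_eq_proportion[OF assms(6)]
    by (simp add: CARD_mod_ring)
qed

end
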